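(* Let $G$ be a connected graph satisfying $\mathrm{CD}(2,\infty)$. If $\lambda_{\deg(o)}=2$ for some vertex $o\in V(G)$, then $G$ is regular.
   Context: All graphs are simple, finite, connected and unweighted. For $f:V(G)\to\mathbb{R}$ put $Lf(x)=\sum_{y\sim x}(f(y)-f(x))$. The eigenvalues of $-L$ are $0=\lambda_0<\lambda_1\le\lambda_2\le\cdots\le\lambda_{|V(G)|-1}$, counted with multiplicity (indexing starts at $0$). The Bakry--Émery operators are $2\Gamma(f,g)=L(fg)-fLg-gLf$ and $2\Gamma_2(f,g)=L\Gamma(f,g)-\Gamma(f,Lg)-\Gamma(g,Lf)$, with $\Gamma(f)=\Gamma(f,f)$ and $\Gamma_2(f)=\Gamma_2(f,f)$. $G$ satisfies $\mathrm{CD}(K,\infty)$ if $\Gamma_2(f)(x)\ge K\,\Gamma(f)(x)$ for all $f:V(G)\to\mathbb{R}$ and all $x\in V(G)$. *)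

theory Defs
  imports "HOL-Analysis.Analysis" "HOL-Library.Multiset"
begin

text \<open>
  A finite simple graph is given by a symmetric, irreflexive adjacency relation on a finite
  vertex type; the vertex set is the whole type.
\<close>

definition vdegree :: "('v::finite \<Rightarrow> 'v \<Rightarrow> bool) \<Rightarrow> 'v \<Rightarrow> nat" where
  "vdegree adj x = card {y. adj x y}"

definition regular_graph :: "('v::finite \<Rightarrow> 'v \<Rightarrow> bool) \<Rightarrow> bool" where
  "regular_graph adj \<longleftrightarrow> (\<exists>d. \<forall>x. vdegree adj x = d)"

definition laplacian :: "('v::finite \<Rightarrow> 'v \<Rightarrow> bool) \<Rightarrow> ('v \<Rightarrow> real) \<Rightarrow> 'v \<Rightarrow> real" where
  "laplacian adj f x = (\<Sum>y | adj x y. f y - f x)"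

definition Gamma ::
  "('v::finite \<Rightarrow> 'v \<Rightarrow> bool) \<Rightarrow> ('v \<Rightarrow> real) \<Rightarrow> ('v \<Rightarrow> real) \<Rightarrow> 'v \<Rightarrow> real" where
  "Gamma adj f g x =
     (laplacian adj (\<lambda>y. f y * g y) x - f x * laplacian adj g x - g x * laplacian adj f x) / 2"

definition Gamma2 ::
  "('v::finite \<Rightarrow> 'v \<Rightarrow> bool) \<Rightarrow> ('v \<Rightarrow> real) \<Rightarrow> ('v \<Rightarrow> real) \<Rightarrow> 'v \<Rightarrow> real" where
  "Gamma2 adj f g x =
     (laplacian adj (Gamma adj f g) x
        - Gamma adj f (laplacian adj g) x - Gamma adj g (laplacian adj f) x) / 2"

definition CD_infinity :: "('v::finite \<Rightarrow> 'v \<Rightarrow> bool) \<Rightarrow> real \<Rightarrow> bool" where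
  "CD_infinity adj K \<longleftrightarrow> (\<forall>f x. Gamma2 adj f f x \<ge> K * Gamma adj f f x)"

text \<open>
  Functions on the vertices are taken here in \<open>real ^ 'v\<close>, so that the library's
  \<^const>\<open>dim\<close> for real vector spaces applies.
\<close>

definition eigenspace :: "('v::finite \<Rightarrow> 'v \<Rightarrow> bool) \<Rightarrow> real \<Rightarrow> (real ^ 'v) set" where
  "eigenspace adj t = {f. \<forall>x. - laplacian adj (\<lambda>y. f $ y) x = t * f $ x}"

definition eigenvalues :: "('v::finite \<Rightarrow> 'v \<Rightarrow> bool) \<Rightarrow> real set" where
  "eigenvalues adj = {t. \<exists>f. f \<noteq> 0 \<and> f \<in> eigenspace adj t}"

text \<open>
  Multiplicities are dimensions of eigenspaces. As \<open>-L\<close> is self-adjoint, they agree with the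
  algebraic ones and the sorted list of eigenvalues has exactly \<open>CARD('v)\<close> entries; hence
  \<open>laplace_eigenvalue adj k\<close> is meaningful for \<open>k < CARD('v)\<close>, in particular for \<open>k = vdegree adj x\<close>.
\<close>

definition eigenvalue_mset :: "('v::finite \<Rightarrow> 'v \<Rightarrow> bool) \<Rightarrow> real multiset" where
  "eigenvalue_mset adj =
     (\<Sum>t\<in>eigenvalues adj. replicate_mset (dim (eigenspace adj t)) t)"

definition laplace_eigenvalue :: "('v::finite \<Rightarrow> 'v \<Rightarrow> bool) \<Rightarrow> nat \<Rightarrow> real" where
  "laplace_eigenvalue adj k = sorted_list_of_multiset (eigenvalue_mset adj) ! k"

end

theory Submission
  imports Defs
begin

text \<open>
  Summing the curvature inequality for an eigenfunction of \<open>-L\<close> over all vertices gives the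
  Lichnerowicz bound: an eigenfunction for an eigenvalue below the curvature \<open>K > 0\<close> is constant. For
  an eigenvalue equal to \<open>K\<close> the summed inequality is an equality, so the curvature inequality
  itself is an equality at every vertex. Two consequences follow for \<open>f\<close> in the eigenspace \<open>E\<close>
  of \<open>K\<close>.

  First, \<open>\<Gamma>(f)\<close> is harmonic and hence constant. Therefore an \<open>f\<close> in \<open>E\<close> whose increments
  along the edges at a single vertex vanish is zero, and the map from \<open>E\<close> to the increments at
  \<open>x\<close> is injective: the dimension \<open>d\<close> of \<open>E\<close> is at most the degree of every vertex. On the
  other hand, the value \<open>2\<close> at index \<open>deg(o)\<close> of the ordered spectrum forces
  \<open>d \<ge> deg(o)\<close>, since only the simple eigenvalue \<open>0\<close> is smaller than \<open>2\<close>. So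
  \<open>d = deg(o)\<close>.

  Second, the quadratic form \<open>\<Gamma>\<^sub>2 - K \<Gamma>\<close> at a vertex is positive semidefinite and vanishes
  at \<open>f\<close>, so it also vanishes when \<open>f\<close> is paired with an arbitrary function \<open>h\<close>
  (lemma \<open>Gamma2_eigen_extremal_polar\<close>). If \<open>deg(x) = d\<close>, the increment map at \<open>x\<close> is
  bijective, and for each neighbour \<open>y\<close> there is an \<open>f\<close> in \<open>E\<close> whose only nonzero increment at
  \<open>x\<close> is the one towards \<open>y\<close>. Pairing this \<open>f\<close> with the indicator function of \<open>y\<close> gives
  \<open>deg(y) + t = deg(x)\<close>, where \<open>t\<close> counts the triangles on the edge \<open>xy\<close>
  (lemma \<open>vdegree_neighbour\<close>). As \<open>deg(y) \<ge> d\<close>, also \<open>deg(y) = d\<close>, and by connectedness the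
  degree \<open>d\<close> propagates from \<open>o\<close> to all vertices.

  Reading off dimensions from the ordered list of eigenvalues presupposes that the list is long
  enough, that is, that \<open>-L\<close> is diagonalisable. This is the spectral theorem
  \<open>self_adjoint_eigenvectors_span\<close>.
\<close>

section \<open>Calculus on a finite graph\<close>

lemma Gamma_alt:
  "Gamma adj f g x = (\<Sum>y | adj x y. (f y - f x) * (g y - g x)) / 2"
proof -
  have "(\<Sum>y | adj x y. (f y - f x) * (g y - g x)) =
    (\<Sum>y | adj x y. (f y * g y - f x * g x) - f x * (g y - g x) - g x * (f y - f x))"
    by (rule sum.cong) (auto simp: algebra_simps)
  also have "\<dots> = 2 * Gamma adj f g x"
    unfolding sum_subtractf[of _ "\<lambda>y. g x * (f y - f x)"]
      sum_subtractf[of _ "\<lambda>y. f x * (g y - g x)"]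
    by (simp only: Gamma_def laplacian_def flip: sum_distrib_left) simp
  finally show ?thesis by simp
qed

lemma laplacian_add: "laplacian adj (\<lambda>y. f y + g y) x = laplacian adj f x + laplacian adj g x"
  unfolding laplacian_def sum.distrib[symmetric] by (rule sum.cong) auto

lemma laplacian_cmult: "laplacian adj (\<lambda>y. c * f y) x = c * laplacian adj f x"
  unfolding laplacian_def sum_distrib_left by (rule sum.cong) (auto simp: algebra_simps)

lemma laplacian_vec_add:
  "laplacian adj (($) (f + g)) x = laplacian adj (($) f) x + laplacian adj (($) g) x"
proof -
  have "($) (f + g) = (\<lambda>y. f $ y + g $ y)" by (rule ext) simp
  then show ?thesis by (simp only: laplacian_add)
qed

lemma laplacian_vec_scaleR:
  "laplacian adj (($) (c *\<^sub>R f)) x = c * laplacian adj (($) f) x"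
proof -
  have "($) (c *\<^sub>R f) = (\<lambda>y. c * f $ y)" by (rule ext) simp
  then show ?thesis by (simp only: laplacian_cmult)
qed

lemma Gamma_commute: "Gamma adj f g x = Gamma adj g f x"
  by (simp add: Gamma_alt mult.commute)

lemma Gamma2_commute: "Gamma2 adj f g x = Gamma2 adj g f x"
proof -
  have "Gamma adj f g = Gamma adj g f" by (rule ext) (rule Gamma_commute)
  then show ?thesis by (simp add: Gamma2_def)
qed

lemma Gamma_add_right: "Gamma adj f (\<lambda>y. g y + h y) x = Gamma adj f g x + Gamma adj f h x"
  unfolding Gamma_alt add_divide_distrib[symmetric] sum.distrib[symmetric]
  by (intro arg_cong[where f = "\<lambda>s. s / 2"] sum.cong) (auto simp: algebra_simps)

lemma Gamma_cmult_right: "Gamma adj f (\<lambda>y. c * g y) x = c * Gamma adj f g x"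
proof -
  have "(\<Sum>y | adj x y. (f y - f x) * (c * g y - c * g x))
      = c * (\<Sum>y | adj x y. (f y - f x) * (g y - g x))"
    unfolding sum_distrib_left by (rule sum.cong) (auto simp: algebra_simps)
  then show ?thesis by (simp add: Gamma_alt)
qed

lemma Gamma_nonneg: "Gamma adj f f x \<ge> 0"
  by (simp add: Gamma_alt sum_nonneg)

lemma Gamma2_add_right: "Gamma2 adj f (\<lambda>y. g y + h y) x = Gamma2 adj f g x + Gamma2 adj f h x"
proof -
  have 1: "Gamma adj f (\<lambda>y. g y + h y) = (\<lambda>x. Gamma adj f g x + Gamma adj f h x)"
    by (simp add: Gamma_add_right fun_eq_iff)
  have 2: "laplacian adj (\<lambda>y. g y + h y) = (\<lambda>x. laplacian adj g x + laplacian adj h x)"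
    by (simp add: laplacian_add fun_eq_iff)
  have 3: "Gamma adj (\<lambda>y. g y + h y) k x = Gamma adj g k x + Gamma adj h k x" for k
    using Gamma_add_right[of adj k g h x] by (simp add: Gamma_commute)
  show ?thesis
    unfolding Gamma2_def 1 2 3 laplacian_add Gamma_add_right by (simp add: field_simps)
qed

lemma Gamma2_cmult_right: "Gamma2 adj f (\<lambda>y. c * g y) x = c * Gamma2 adj f g x"
proof -
  have 1: "Gamma adj f (\<lambda>y. c * g y) = (\<lambda>x. c * Gamma adj f g x)"
    by (simp add: Gamma_cmult_right fun_eq_iff)
  have 2: "laplacian adj (\<lambda>y. c * g y) = (\<lambda>x. c * laplacian adj g x)"
    by (simp add: laplacian_cmult fun_eq_iff)
  have 3: "Gamma adj (\<lambda>y. c * g y) k x = c * Gamma adj g k x" for k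
    using Gamma_cmult_right[of adj k c g x] by (simp add: Gamma_commute)
  show ?thesis
    unfolding Gamma2_def 1 2 3 laplacian_cmult Gamma_cmult_right by (simp add: field_simps)
qed

lemma sum_edges_antisym:
  fixes F :: "'v::finite \<Rightarrow> 'v \<Rightarrow> real"
  assumes "symp adj" and anti: "\<And>x y. F y x = - F x y"
  shows "(\<Sum>x\<in>UNIV. \<Sum>y | adj x y. F x y) = 0"
proof -
  have "(\<Sum>x\<in>UNIV. \<Sum>y | adj x y. F x y) = (\<Sum>y\<in>UNIV. \<Sum>x | adj x y. F x y)"
    using sum.swap_restrict[of UNIV UNIV F adj] by simp
  also have "\<dots> = (\<Sum>y\<in>UNIV. \<Sum>x | adj y x. - F y x)"
    using sympD[OF \<open>symp adj\<close>] by (intro sum.cong refl Collect_cong iffI anti) auto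
  also have "\<dots> = - (\<Sum>x\<in>UNIV. \<Sum>y | adj x y. F x y)"
    by (simp add: sum_negf)
  finally show ?thesis by simp
qed

lemma sum_laplacian:
  assumes "symp adj"
  shows "(\<Sum>x\<in>UNIV. laplacian adj f x) = 0"
  unfolding laplacian_def by (rule sum_edges_antisym[OF assms]) simp

lemma laplacian_self_adjoint:
  assumes "symp adj"
  shows "(\<Sum>x\<in>UNIV. f x * laplacian adj g x) = (\<Sum>x\<in>UNIV. g x * laplacian adj f x)"
proof -
  have "(\<Sum>x\<in>UNIV. f x * laplacian adj g x) - (\<Sum>x\<in>UNIV. g x * laplacian adj f x)
      = (\<Sum>x\<in>UNIV. \<Sum>y | adj x y. f x * g y - g x * f y)"
    unfolding laplacian_def sum_distrib_left sum_subtractf[symmetric]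
    by (intro sum.cong refl) (auto simp: algebra_simps)
  also have "\<dots> = 0" by (rule sum_edges_antisym[OF assms]) simp
  finally show ?thesis by simp
qed

lemma sum_Gamma:
  assumes "symp adj"
  shows "(\<Sum>x\<in>UNIV. Gamma adj f g x) = - (\<Sum>x\<in>UNIV. f x * laplacian adj g x)"
  using sum_laplacian[OF assms, of "\<lambda>y. f y * g y"] laplacian_self_adjoint[OF assms, of f g]
  by (simp add: Gamma_def sum_subtractf flip: sum_divide_distrib)

lemma sum_Gamma2:
  assumes "symp adj"
  shows "(\<Sum>x\<in>UNIV. Gamma2 adj f f x) = - (\<Sum>x\<in>UNIV. Gamma adj f (laplacian adj f) x)"
proof -
  have "Gamma2 adj f f x = laplacian adj (Gamma adj f f) x / 2 - Gamma adj f (laplacian adj f) x" for x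
    by (simp add: Gamma2_def)
  then show ?thesis
    using sum_laplacian[OF assms, of "Gamma adj f f"]
    by (simp add: sum_subtractf flip: sum_divide_distrib)
qed

lemma Gamma_eq_0_imp_const:
  assumes conn: "\<forall>x y. adj\<^sup>*\<^sup>* x y" and G: "\<And>x. Gamma adj f f x = 0"
  shows "f x = f y"
proof -
  have step: "f z = f w" if "adj w z" for w z
  proof -
    have "(\<Sum>y | adj w y. (f y - f w)\<^sup>2) = 0"
      using G[of w] by (simp add: Gamma_alt power2_eq_square)
    then have "\<forall>y\<in>{y. adj w y}. (f y - f w)\<^sup>2 = 0"
      by (subst (asm) sum_nonneg_eq_0_iff) auto
    with that show ?thesis by simp
  qed
  have "adj\<^sup>*\<^sup>* x y" using conn by blast
  then show ?thesis by induction (auto dest: step)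
qed

lemma harmonic_imp_const:
  assumes "symp adj" "\<forall>x y. adj\<^sup>*\<^sup>* x y" and "\<And>x. laplacian adj f x = 0"
  shows "f x = f y"
proof -
  have "(\<Sum>x\<in>UNIV. Gamma adj f f x) = 0"
    using sum_Gamma[OF assms(1), of f f] assms(3) by simp
  then have "Gamma adj f f z = 0" for z
    by (subst (asm) sum_nonneg_eq_0_iff) (auto simp: Gamma_nonneg)
  with assms(2) show ?thesis by (rule Gamma_eq_0_imp_const)
qed

section \<open>Eigenfunctions under a curvature bound\<close>

lemma laplacian_eigen:
  assumes "f \<in> eigenspace adj t"
  shows "laplacian adj (($) f) x = - t * f $ x"
proof -
  have "- laplacian adj (($) f) x = t * f $ x"
    using assms unfolding eigenspace_def by blast
  then show ?thesis by linarith
qed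

lemma Gamma_eigen:
  assumes "f \<in> eigenspace adj t"
  shows "Gamma adj h (laplacian adj (($) f)) x = - t * Gamma adj h (($) f) x"
proof -
  have "laplacian adj (($) f) = (\<lambda>y. - t * f $ y)"
    by (rule ext) (rule laplacian_eigen[OF assms])
  then show ?thesis by (simp only: Gamma_cmult_right)
qed

lemma sum_Gamma2_eigen:
  assumes "symp adj" and "f \<in> eigenspace adj t"
  shows "(\<Sum>x\<in>UNIV. Gamma2 adj (($) f) (($) f) x) = t * (\<Sum>x\<in>UNIV. Gamma adj (($) f) (($) f) x)"
  by (simp add: sum_Gamma2[OF assms(1)] Gamma_eigen[OF assms(2)] sum_negf sum_distrib_left)

text \<open>
  Lichnerowicz: by \<open>sum_Gamma2_eigen\<close> the summed curvature inequality reads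
  \<open>(t - K) \<Sum>\<Gamma>(f) \<ge> 0\<close>, which for \<open>t < K\<close> leaves no room for a nonzero gradient.
\<close>

lemma eigen_below_curvature_const:
  assumes "symp adj" "\<forall>x y. adj\<^sup>*\<^sup>* x y" "CD_infinity adj K"
    and f: "f \<in> eigenspace adj t" and "t < K"
  shows "f $ x = f $ y"
proof -
  let ?G = "\<lambda>x. Gamma adj (($) f) (($) f) x"
  have "K * (\<Sum>x\<in>UNIV. ?G x) \<le> (\<Sum>x\<in>UNIV. Gamma2 adj (($) f) (($) f) x)"
    unfolding sum_distrib_left using assms(3) by (intro sum_mono) (auto simp: CD_infinity_def)
  then have "(K - t) * (\<Sum>x\<in>UNIV. ?G x) \<le> 0"
    by (simp add: sum_Gamma2_eigen[OF assms(1) f] algebra_simps)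
  with \<open>t < K\<close> have "(\<Sum>x\<in>UNIV. ?G x) \<le> 0"
    by (simp add: mult_le_0_iff)
  moreover have "(\<Sum>x\<in>UNIV. ?G x) \<ge> 0" by (simp add: sum_nonneg Gamma_nonneg)
  ultimately have "(\<Sum>x\<in>UNIV. ?G x) = 0" by linarith
  then have "?G z = 0" for z
    by (subst (asm) sum_nonneg_eq_0_iff) (auto simp: Gamma_nonneg)
  with assms(2) show ?thesis by (rule Gamma_eq_0_imp_const)
qed

text \<open>
  At \<open>t = K\<close> both sides of the curvature inequality have the same sum over the vertices, so the
  pointwise inequalities cannot be strict anywhere.
\<close>

lemma Gamma2_eigen_extremal:
  assumes "symp adj" "CD_infinity adj K" and f: "f \<in> eigenspace adj K"
  shows "Gamma2 adj (($) f) (($) f) x = K * Gamma adj (($) f) (($) f) x"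
proof -
  let ?D = "\<lambda>x. Gamma2 adj (($) f) (($) f) x - K * Gamma adj (($) f) (($) f) x"
  have "(\<Sum>x\<in>UNIV. ?D x) = 0"
    by (simp add: sum_subtractf sum_Gamma2_eigen[OF assms(1) f] sum_distrib_left)
  then have "?D x = 0"
    using assms(2) by (subst (asm) sum_nonneg_eq_0_iff) (auto simp: CD_infinity_def)
  then show ?thesis by simp
qed

text \<open>
  A positive semidefinite form that vanishes at \<open>u\<close> also vanishes on \<open>(u, v)\<close> for every \<open>v\<close>:
  its value at \<open>u + c v\<close> is the polynomial in \<open>c\<close> below.
\<close>

lemma nonneg_quadratic_imp_linear_coeff_0:
  fixes a b :: real
  assumes "\<And>c. 2 * c * b + c\<^sup>2 * a \<ge> 0"
  shows "b = 0"
proof -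
  have "2 * 1 * b + 1\<^sup>2 * a \<ge> 0" "2 * (-1) * b + (-1)\<^sup>2 * a \<ge> 0" by (rule assms)+
  then have a: "a \<ge> 0" by simp
  \<comment> \<open>Not the minimiser \<open>- b / a\<close>, so that \<open>a = 0\<close> is covered as well.\<close>
  define c where "c = - b / (a + 1)"
  have b: "b = - c * (a + 1)" using a by (simp add: c_def)
  have "2 * c * b + c\<^sup>2 * a = - (c\<^sup>2 * (a + 2))"
    unfolding b by (simp add: algebra_simps power2_eq_square)
  then have "c\<^sup>2 * (a + 2) \<le> 0" using assms[of c] by linarith
  then have "c\<^sup>2 \<le> 0" using a by (simp add: mult_le_0_iff)
  then have "c = 0" by simp
  with b show ?thesis by simp
qed

text \<open>
  The curvature condition is used here for the perturbations \<open>f + c h\<close> of an extremal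
  eigenfunction, with an arbitrary function \<open>h\<close>.
\<close>

lemma Gamma2_eigen_extremal_polar:
  assumes "symp adj" "CD_infinity adj K" and f: "f \<in> eigenspace adj K"
  shows "Gamma2 adj (($) f) h x = K * Gamma adj (($) f) h x"
proof -
  define Q where "Q = (\<lambda>f g. Gamma2 adj f g x - K * Gamma adj f g x)"
  have add: "Q f (\<lambda>y. g y + h y) = Q f g + Q f h" for f g h
    by (simp add: Q_def Gamma2_add_right Gamma_add_right algebra_simps)
  have cmult: "Q f (\<lambda>y. c * g y) = c * Q f g" for f g c
    by (simp add: Q_def Gamma2_cmult_right Gamma_cmult_right algebra_simps)
  have comm: "Q f g = Q g f" for f g
    by (simp add: Q_def Gamma2_commute[of adj f] Gamma_commute[of adj f])
  have ff: "Q (($) f) (($) f) = 0"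
    by (simp add: Q_def Gamma2_eigen_extremal[OF assms])
  have "2 * c * Q (($) f) h + c\<^sup>2 * Q h h \<ge> 0" for c
  proof -
    let ?g = "\<lambda>y. f $ y + c * h y"
    have "Q ?g ?g \<ge> 0" using assms(2) by (simp add: Q_def CD_infinity_def)
    moreover have "Q ?g ?g = 2 * c * Q (($) f) h + c\<^sup>2 * Q h h"
    proof -
      have "Q ?g ?g = Q ?g (($) f) + c * Q ?g h" by (simp only: add cmult)
      also have "Q ?g (($) f) = Q (($) f) ?g" by (rule comm)
      also have "Q ?g h = Q h ?g" by (rule comm)
      also have "Q (($) f) ?g = c * Q (($) f) h" by (simp only: add cmult ff add_0_left)
      also have "Q h ?g = Q h (($) f) + c * Q h h" by (simp only: add cmult)
      also have "Q h (($) f) = Q (($) f) h" by (rule comm)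
      finally show ?thesis by (simp add: algebra_simps power2_eq_square)
    qed
    ultimately show ?thesis by simp
  qed
  then have "Q (($) f) h = 0" by (rule nonneg_quadratic_imp_linear_coeff_0)
  then show ?thesis by (simp add: Q_def)
qed

text \<open>
  For an eigenfunction \<open>2 \<Gamma>\<^sub>2(f) = L\<Gamma>(f) + 2 K \<Gamma>(f)\<close>, so extremality says exactly that
  \<open>\<Gamma>(f)\<close> is harmonic.
\<close>

lemma Gamma_eigen_extremal_const:
  assumes "symp adj" "\<forall>x y. adj\<^sup>*\<^sup>* x y" "CD_infinity adj K" and f: "f \<in> eigenspace adj K"
  shows "Gamma adj (($) f) (($) f) x = Gamma adj (($) f) (($) f) y"
proof -
  have "laplacian adj (Gamma adj (($) f) (($) f)) z = 0" for z
    using Gamma2_eigen_extremal[OF assms(1,3) f, of z]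
    unfolding Gamma2_def Gamma_eigen[OF f] by simp
  with assms(1,2) show ?thesis by (rule harmonic_imp_const)
qed

section \<open>The gradient of an extremal eigenfunction at a vertex\<close>

text \<open>
  The padding by \<open>0\<close> away from the neighbours of \<open>x\<close> keeps all gradients in one vector space.
\<close>

definition gradient_at :: "('v::finite \<Rightarrow> 'v \<Rightarrow> bool) \<Rightarrow> 'v \<Rightarrow> real ^ 'v \<Rightarrow> real ^ 'v" where
  "gradient_at adj x f = (\<chi> y. if adj x y then f $ y - f $ x else 0)"

lemma linear_gradient_at: "linear (gradient_at adj x)"
  by (rule linearI) (auto simp: gradient_at_def vec_eq_iff algebra_simps)

lemma mem_eigenspace_iff:
  "f \<in> eigenspace adj t \<longleftrightarrow> (\<forall>x. laplacian adj (($) f) x = - t * f $ x)"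
proof -
  have "- laplacian adj (($) f) x = t * f $ x \<longleftrightarrow> laplacian adj (($) f) x = - t * f $ x" for x
    by auto
  then show ?thesis by (simp only: eigenspace_def mem_Collect_eq)
qed

lemma subspace_eigenspace: "subspace (eigenspace adj t)"
proof (rule subspaceI)
  show "0 \<in> eigenspace adj t" by (simp add: mem_eigenspace_iff laplacian_def)
qed (simp_all add: mem_eigenspace_iff laplacian_vec_add laplacian_vec_scaleR algebra_simps)

text \<open>
  If the gradient of \<open>f\<close> vanishes at one vertex then so does \<open>\<Gamma>(f)\<close>, which is constant; hence
  \<open>f\<close> is constant, and \<open>0\<close> is the only constant with a nonzero eigenvalue.
\<close>

lemma inj_on_gradient_at:
  assumes "symp adj" "\<forall>x y. adj\<^sup>*\<^sup>* x y" "CD_infinity adj K" "K \<noteq> 0"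
  shows "inj_on (gradient_at adj x) (eigenspace adj K)"
proof -
  have "f = 0" if f: "f \<in> eigenspace adj K" and 0: "gradient_at adj x f = 0" for f
  proof -
    have "Gamma adj (($) f) (($) f) x = 0"
    proof -
      have "f $ y - f $ x = 0" if "adj x y" for y
      proof -
        have "gradient_at adj x f $ y = 0" using 0 by simp
        with that show ?thesis by (simp add: gradient_at_def)
      qed
      then show ?thesis by (simp add: Gamma_alt)
    qed
    then have "Gamma adj (($) f) (($) f) y = 0" for y
      using Gamma_eigen_extremal_const[OF assms(1-3) f, of y x] by simp
    then have "f $ y = f $ z" for y z by (rule Gamma_eq_0_imp_const[OF assms(2)])
    then have const: "f $ y - f $ z = 0" for y z by simp
    have "f $ z = 0" for z
    proof -
      have "laplacian adj (($) f) z = 0"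
        by (simp add: laplacian_def const)
      with laplacian_eigen[OF f, of z] \<open>K \<noteq> 0\<close> show ?thesis by simp
    qed
    then show ?thesis by (simp add: vec_eq_iff)
  qed
  then show ?thesis
    using linear_inj_on_iff_eq_0[OF linear_gradient_at subspace_eigenspace] by blast
qed

lemma gradient_at_image:
  "gradient_at adj x ` S \<subseteq> {v. \<forall>y. y \<notin> {y. adj x y} \<longrightarrow> v $ y = 0}"
  by (auto simp: gradient_at_def)

lemma dim_gradient_image:
  assumes "symp adj" "\<forall>x y. adj\<^sup>*\<^sup>* x y" "CD_infinity adj K" "K \<noteq> 0"
  shows "dim (gradient_at adj x ` eigenspace adj K) = dim (eigenspace adj K)"
  using dim_image_eq[OF linear_gradient_at, of adj x "eigenspace adj K"] inj_on_gradient_at[OF assms]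
    span_eq_iff[THEN iffD2, OF subspace_eigenspace[of adj K]] by metis

lemma dim_vectors_on_neighbours:
  "dim {v :: real ^ 'v::finite. \<forall>y. y \<notin> {y. adj x y} \<longrightarrow> v $ y = 0} = vdegree adj x"
  unfolding vdegree_def dim_vec_eq[symmetric] by (rule dim_substandard_cart)

lemma dim_extremal_eigenspace_le_vdegree:
  assumes "symp adj" "\<forall>x y. adj\<^sup>*\<^sup>* x y" "CD_infinity adj K" "K \<noteq> 0"
  shows "dim (eigenspace adj K) \<le> vdegree adj x"
  using dim_subset[OF gradient_at_image[of adj x "eigenspace adj K"]]
  unfolding dim_gradient_image[OF assms] dim_vectors_on_neighbours .

text \<open>
  Once the degree of \<open>x\<close> does not exceed the dimension of the eigenspace, the injective gradient
  map is onto the functions on the neighbours of \<open>x\<close>.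
\<close>

lemma extremal_eigenfunction_with_gradient:
  fixes adj :: "'v::finite \<Rightarrow> 'v \<Rightarrow> bool"
  assumes "symp adj" "\<forall>x y. adj\<^sup>*\<^sup>* x y" "CD_infinity adj K" "K \<noteq> 0"
    and "vdegree adj x \<le> dim (eigenspace adj K)" and "adj x y"
  obtains f where "f \<in> eigenspace adj K" and "gradient_at adj x f = axis y 1"
proof -
  let ?V = "{v :: real ^ 'v. \<forall>y. y \<notin> {y. adj x y} \<longrightarrow> v $ y = 0}"
  have "gradient_at adj x ` eigenspace adj K = ?V"
  proof (rule subspace_dim_equal)
    show "subspace (gradient_at adj x ` eigenspace adj K)"
      by (intro linear_subspace_image linear_gradient_at subspace_eigenspace)
    show "subspace ?V" by (auto simp: subspace_def)
    show "dim ?V \<le> dim (gradient_at adj x ` eigenspace adj K)"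
      unfolding dim_vectors_on_neighbours dim_gradient_image[OF assms(1-4)] by (rule assms(5))
  qed (rule gradient_at_image)
  moreover have "axis y 1 \<in> ?V" using \<open>adj x y\<close> by (auto simp: axis_def)
  ultimately have "axis y 1 \<in> gradient_at adj x ` eigenspace adj K" by simp
  then show ?thesis using that by fastforce
qed

text \<open>
  The equation of \<open>Gamma2_eigen_extremal_polar\<close> is evaluated at \<open>x\<close> for the indicator
  function \<open>h\<close> of \<open>y\<close>. Both the increments of \<open>f\<close> and those of \<open>h\<close> at \<open>x\<close> are then
  concentrated on the edge \<open>xy\<close>. The degree of \<open>y\<close> enters through \<open>L h(y)\<close>, the degree of
  \<open>x\<close> and the triangles on \<open>xy\<close> through the values \<open>\<Gamma>(f,h)(w)\<close> at the other neighbours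
  \<open>w\<close> of \<open>x\<close>.
\<close>

lemma vdegree_neighbour:
  fixes adj :: "'v::finite \<Rightarrow> 'v \<Rightarrow> bool"
  assumes "symp adj" "irreflp adj" "CD_infinity adj K"
    and f: "f \<in> eigenspace adj K" and grad: "gradient_at adj x f = axis y 1" and "adj x y"
  shows "vdegree adj y + card {w. adj x w \<and> adj w y} = vdegree adj x"
proof -
  define h where "h = (\<lambda>z. if z = y then 1 else 0 :: real)"
  define N where "N = {w. adj x w} - {y}"
  define C where "C = {w. adj x w \<and> adj w y}"
  note sym = sympD[OF \<open>symp adj\<close>]
  have irr: "\<not> adj z z" for z using \<open>irreflp adj\<close> by (auto simp: irreflp_def)
  have [simp]: "x \<noteq> y" "adj x y" "adj y x" using \<open>adj x y\<close> irr sym by auto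
  have split: "(\<Sum>w | adj x w. F w) = F y + (\<Sum>w\<in>N. F w)" for F :: "'v \<Rightarrow> real"
    unfolding N_def by (rule sum.remove) auto
  have df: "f $ w - f $ x = (if w = y then 1 else 0)" if "adj x w" for w
  proof -
    have "gradient_at adj x f $ w = axis y 1 $ w" using grad by simp
    with that show ?thesis by (simp add: gradient_at_def axis_def split: if_splits)
  qed
  have fy: "f $ y = f $ x + 1" using df[of y] by simp
  have fN: "f $ w = f $ x" if "w \<in> N" for w using df[of w] that by (auto simp: N_def)
  have Lf: "laplacian adj (($) f) x = 1"
    unfolding laplacian_def by (subst split) (simp add: fy fN)
  then have fx: "K * f $ x = - 1" using laplacian_eigen[OF f, of x] by simp
  have Gx: "Gamma adj (($) f) h x = 1 / 2"
    unfolding Gamma_alt by (subst split) (simp add: fy fN h_def)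
  have Gy: "Gamma adj (($) f) h y = (K - 1) / 2"
  proof -
    have "(\<Sum>w | adj y w. (f $ w - f $ y) * (h w - h y)) = (\<Sum>w | adj y w. - (f $ w - f $ y))"
      by (rule sum.cong) (auto simp: h_def irr)
    also have "\<dots> = - laplacian adj (($) f) y" unfolding laplacian_def by (rule sum_negf)
    also have "\<dots> = K - 1"
      using laplacian_eigen[OF f, of y] fx by (simp add: fy algebra_simps)
    finally show ?thesis by (simp add: Gamma_alt)
  qed
  have GN: "Gamma adj (($) f) h w = (if adj w y then 1 / 2 else 0)" if "w \<in> N" for w
  proof -
    have "w \<noteq> y" using that by (simp add: N_def)
    then have "(\<Sum>z | adj w z. (f $ z - f $ w) * (h z - h w)) 
      = (\<Sum>z | adj w z. if z = y then f $ y - f $ w else 0)"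
      by (intro sum.cong) (auto simp: h_def)
    also have "\<dots> = (if adj w y then 1 else 0)"
      by (simp add: fy fN[OF that])
    finally show ?thesis by (simp add: Gamma_alt)
  qed
  have card_N: "real (card N) = real (vdegree adj x) - 1"
    using split[of "\<lambda>_. 1"] by (simp add: vdegree_def)
  have C: "C = N \<inter> {w. adj w y}" by (auto simp: C_def N_def irr)
  have "(\<Sum>w\<in>N. Gamma adj (($) f) h w) = real (card C) / 2"
    by (simp add: GN sum.If_cases C)
  then have "(\<Sum>w\<in>N. Gamma adj (($) f) h w - 1 / 2) = (card C - (real (vdegree adj x) - 1)) / 2"
    by (simp add: sum_subtractf card_N diff_divide_distrib)
  then have LG: "laplacian adj (Gamma adj (($) f) h) x = (card C - (real (vdegree adj x) - 1) + (K - 2)) / 2"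
    unfolding laplacian_def by (subst split) (simp add: Gx Gy field_simps)
  have Lhy: "laplacian adj h y = - real (vdegree adj y)"
  proof -
    have "(\<Sum>w | adj y w. h w - h y) = (\<Sum>w | adj y w. - 1)"
      by (rule sum.cong) (auto simp: h_def irr)
    then show ?thesis by (simp add: laplacian_def vdegree_def)
  qed
  have Lhx: "laplacian adj h x = 1"
    unfolding laplacian_def by (subst split) (simp add: h_def N_def)
  have GL: "Gamma adj (($) f) (laplacian adj h) x = (- real (vdegree adj y) - 1) / 2"
    unfolding Gamma_alt by (subst split) (simp add: fy fN Lhy Lhx)
  have "Gamma2 adj (($) f) h x = K / 2"
    using Gamma2_eigen_extremal_polar[OF assms(1,3) f, of h x] Gx by simp
  moreover have "Gamma adj h (laplacian adj (($) f)) x = - K / 2"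
    using Gamma_eigen[OF f, of h x] Gx by (simp add: Gamma_commute[of adj h])
  ultimately have "real (card C) + real (vdegree adj y) = real (vdegree adj x)"
    unfolding Gamma2_def LG GL by (simp add: field_simps)
  then show ?thesis unfolding C_def by linarith
qed

section \<open>Diagonalisation of self-adjoint maps\<close>

text \<open>
  The orthogonal complement \<open>W\<close> of all eigenvectors is invariant under \<open>T\<close>. If it were nonzero,
  the Rayleigh quotient would attain a maximum \<open>m\<close> on its unit sphere, at \<open>u\<close> say. Then
  \<open>m (w \<bullet> w) - w \<bullet> T w\<close> is a positive semidefinite form on \<open>W\<close> that vanishes at \<open>u\<close>, which
  makes \<open>u\<close> an eigenvector orthogonal to itself.
\<close>

lemma self_adjoint_eigenvectors_span:
  fixes T :: "'a::euclidean_space \<Rightarrow> 'a"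
  assumes lin: "linear T" and adj: "\<And>u v. T u \<bullet> v = u \<bullet> T v"
  shows "span {v. \<exists>t. T v = t *\<^sub>R v} = UNIV"
proof (rule ccontr)
  let ?E = "{v. \<exists>t. T v = t *\<^sub>R v}"
  define W where "W = {w. \<forall>v\<in>?E. v \<bullet> w = 0}"
  assume "span ?E \<noteq> UNIV"
  then have "span ?E \<subset> span UNIV" by auto
  then obtain w0 where w0: "w0 \<noteq> 0" "\<And>v. v \<in> span ?E \<Longrightarrow> orthogonal w0 v"
    using orthogonal_to_subspace_exists_gen[of ?E UNIV] by auto
  have subW: "subspace W" by (auto simp: subspace_def W_def inner_simps)
  have w0W: "w0 \<in> W"
    using w0(2) span_base[of _ ?E] by (auto simp: W_def orthogonal_def inner_commute)
  have TW: "T w \<in> W" if "w \<in> W" for w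
  proof -
    have "v \<bullet> T w = 0" if "v \<in> ?E" for v
    proof -
      obtain t where "T v = t *\<^sub>R v" using \<open>v \<in> ?E\<close> by blast
      with \<open>w \<in> W\<close> \<open>v \<in> ?E\<close> show ?thesis by (simp add: W_def flip: adj)
    qed
    then show ?thesis by (simp add: W_def)
  qed
  have "compact (sphere 0 1 \<inter> W)"
    by (intro compact_Int_closed compact_sphere closed_subspace subW)
  moreover have "w0 /\<^sub>R norm w0 \<in> sphere 0 1 \<inter> W"
    using w0(1) w0W subspace_scale[OF subW] by simp
  moreover have "continuous_on (sphere 0 1 \<inter> W) (\<lambda>w. w \<bullet> T w)"
    by (intro continuous_intros linear_continuous_on linear_conv_bounded_linear[THEN iffD1] lin)
  ultimately obtain u where u: "u \<in> W" "norm u = 1"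
    and max: "\<And>w. w \<in> sphere 0 1 \<inter> W \<Longrightarrow> w \<bullet> T w \<le> u \<bullet> T u"
    using continuous_attains_sup[of "sphere 0 1 \<inter> W" "\<lambda>w. w \<bullet> T w"] by fastforce
  define m where "m = u \<bullet> T u"
  have nonneg: "m * (w \<bullet> w) - w \<bullet> T w \<ge> 0" if "w \<in> W" for w
  proof (cases "w = 0")
    case False
    let ?w = "w /\<^sub>R norm w"
    have "?w \<in> sphere 0 1 \<inter> W" using False that subspace_scale[OF subW] by simp
    then have "?w \<bullet> T ?w \<le> m" unfolding m_def by (rule max)
    moreover have "?w \<bullet> T ?w = (w \<bullet> T w) / (norm w)\<^sup>2"
      using False by (simp add: linear_scale[OF lin] power2_eq_square field_simps)
    ultimately show ?thesis using False
      by (simp add: divide_le_eq power2_norm_eq_inner)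
  qed simp
  \<comment> \<open>The form paired with \<open>u\<close> is the inner product with \<open>r\<close>; testing it on \<open>r\<close> itself shows \<open>r = 0\<close>.\<close>
  define r where "r = m *\<^sub>R u - T u"
  have rW: "r \<in> W" unfolding r_def using u TW subW by (simp add: subspace_diff subspace_scale)
  have "2 * c * (r \<bullet> r) + c\<^sup>2 * (m * (r \<bullet> r) - r \<bullet> T r) \<ge> 0" for c
  proof -
    have "u + c *\<^sub>R r \<in> W" using u rW subW by (simp add: subspace_add subspace_scale)
    from nonneg[OF this]
    have "m * ((u + c *\<^sub>R r) \<bullet> (u + c *\<^sub>R r)) - (u + c *\<^sub>R r) \<bullet> T (u + c *\<^sub>R r) \<ge> 0" .
    moreover have "u \<bullet> u = 1" using u(2) by (simp add: norm_eq_1)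
    moreover have "T u \<bullet> r = m * (u \<bullet> r) - r \<bullet> r"
    proof -
      have "T u = m *\<^sub>R u - r" by (simp add: r_def)
      then show ?thesis by (simp add: inner_diff_left)
    qed
    moreover have "u \<bullet> T r = T u \<bullet> r" by (simp add: adj)
    moreover have "r \<bullet> T u = T u \<bullet> r" by (rule inner_commute)
    moreover have "r \<bullet> u = u \<bullet> r" by (rule inner_commute)
    ultimately show ?thesis
      by (simp add: linear_add[OF lin] linear_scale[OF lin] inner_add_left inner_add_right
          m_def[symmetric] algebra_simps power2_eq_square)
  qed
  then have "r \<bullet> r = 0" by (rule nonneg_quadratic_imp_linear_coeff_0)
  then have "T u = m *\<^sub>R u" by (simp add: r_def)
  then have "u \<in> ?E" by blast
  with u(1) have "u \<bullet> u = 0" by (simp add: W_def)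
  with u(2) show False by simp
qed

lemma inner_eigenspaces_eq_0:
  assumes "symp adj" "f \<in> eigenspace adj s" "g \<in> eigenspace adj t" "s \<noteq> t"
  shows "f \<bullet> g = 0"
proof -
  have "(\<Sum>x\<in>UNIV. f $ x * laplacian adj (($) g) x) = (\<Sum>x\<in>UNIV. g $ x * laplacian adj (($) f) x)"
    by (rule laplacian_self_adjoint[OF assms(1)])
  then have "t * (f \<bullet> g) = s * (f \<bullet> g)"
    by (simp add: laplacian_eigen[OF assms(2)] laplacian_eigen[OF assms(3)] inner_vec_def
        sum_negf sum_distrib_left algebra_simps)
  with \<open>s \<noteq> t\<close> show ?thesis by simp
qed

text \<open>
  Eigenvectors chosen one for each eigenvalue are nonzero and pairwise orthogonal, hence
  independent.
\<close>

lemma finite_eigenvalues: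
  fixes adj :: "'v::finite \<Rightarrow> 'v \<Rightarrow> bool"
  assumes "symp adj"
  shows "finite (eigenvalues adj)"
proof -
  define e where "e = (\<lambda>t. SOME f. f \<noteq> 0 \<and> f \<in> eigenspace adj t)"
  have e: "e t \<noteq> 0" "e t \<in> eigenspace adj t" if "t \<in> eigenvalues adj" for t
    using someI_ex[of "\<lambda>f. f \<noteq> 0 \<and> f \<in> eigenspace adj t"] that
    by (auto simp: eigenvalues_def e_def)
  have orth: "e s \<bullet> e t = 0" if "s \<in> eigenvalues adj" "t \<in> eigenvalues adj" "s \<noteq> t" for s t
    using inner_eigenspaces_eq_0[OF assms e(2) e(2)] that by blast
  have "inj_on e (eigenvalues adj)"
    by (rule inj_onI) (metis e(1) orth inner_eq_zero_iff)
  moreover have "finite (e ` eigenvalues adj)"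
  proof (intro independent_imp_finite pairwise_orthogonal_independent)
    show "pairwise orthogonal (e ` eigenvalues adj)"
      by (auto simp: pairwise_def orthogonal_def intro!: orth)
  qed (auto dest: e(1))
  ultimately show ?thesis using finite_imageD by blast
qed

lemma dim_le_sum_dim:
  fixes E :: "'i \<Rightarrow> 'a::euclidean_space set"
  assumes "finite I"
  shows "dim (\<Union>i\<in>I. E i) \<le> (\<Sum>i\<in>I. dim (E i))"
proof -
  have "\<exists>B. B \<subseteq> E i \<and> independent B \<and> E i \<subseteq> span B \<and> card B = dim (E i)" for i
    by (metis basis_exists)
  then obtain B where B: "\<And>i. independent (B i)" "\<And>i. E i \<subseteq> span (B i)" 
    "\<And>i. card (B i) = dim (E i)" by metis
  have "(\<Union>i\<in>I. E i) \<subseteq> span (\<Union>i\<in>I. B i)"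
    using B(2) span_mono[of _ "\<Union>i\<in>I. B i"] by blast
  then have "dim (\<Union>i\<in>I. E i) \<le> card (\<Union>i\<in>I. B i)"
    using assms independent_imp_finite[OF B(1)] by (intro dim_le_card) auto
  also have "\<dots> \<le> (\<Sum>i\<in>I. card (B i))" by (rule card_UN_le[OF assms])
  finally show ?thesis by (simp add: B(3))
qed

text \<open>
  This inequality guarantees that the list of eigenvalues has an entry at every index below the
  number of vertices.
\<close>

lemma CARD_le_sum_dim_eigenspaces:
  fixes adj :: "'v::finite \<Rightarrow> 'v \<Rightarrow> bool"
  assumes "symp adj"
  shows "CARD('v) \<le> (\<Sum>t\<in>eigenvalues adj. dim (eigenspace adj t))"
proof -
  define T where "T = (\<lambda>f :: real ^ 'v. (\<chi> x. - laplacian adj (($) f) x))"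
  have T: "T f = t *\<^sub>R f \<longleftrightarrow> f \<in> eigenspace adj t" for f t
    by (simp add: T_def eigenspace_def vec_eq_iff)
  have "linear T"
    by (rule linearI) (simp_all add: T_def vec_eq_iff laplacian_vec_add laplacian_vec_scaleR)
  moreover have "T f \<bullet> g = f \<bullet> T g" for f g
    using laplacian_self_adjoint[OF assms, of "($) f" "($) g"]
    by (simp add: T_def inner_vec_def sum_negf mult.commute)
  ultimately have "span {f. \<exists>t. T f = t *\<^sub>R f} = UNIV" by (rule self_adjoint_eigenvectors_span)
  then have "dim (UNIV :: (real ^ 'v) set) = dim {f. \<exists>t. f \<in> eigenspace adj t}"
    unfolding T by (metis dim_span)
  also have "\<dots> \<le> dim ({0} \<union> (\<Union>t\<in>eigenvalues adj. eigenspace adj t))"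
    by (intro dim_subset) (auto simp: eigenvalues_def)
  also have "\<dots> = dim (\<Union>t\<in>eigenvalues adj. eigenspace adj t)"
    using dim_span[of "insert 0 (\<Union>t\<in>eigenvalues adj. eigenspace adj t)"]
    by (simp add: span_insert_0)
  also have "\<dots> \<le> (\<Sum>t\<in>eigenvalues adj. dim (eigenspace adj t))"
    by (rule dim_le_sum_dim[OF finite_eigenvalues[OF assms]])
  finally show ?thesis by simp
qed

section \<open>Counting eigenvalues\<close>

lemma size_eigenvalue_mset_ge:
  fixes adj :: "'v::finite \<Rightarrow> 'v \<Rightarrow> bool"
  assumes "symp adj"
  shows "CARD('v) \<le> size (eigenvalue_mset adj)"
  using CARD_le_sum_dim_eigenspaces[OF assms] 
  by (simp add: eigenvalue_mset_def)

lemma count_eigenvalue_mset: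
  assumes "symp adj"
  shows "count (eigenvalue_mset adj) t = (if t \<in> eigenvalues adj then dim (eigenspace adj t) else 0)"
  using finite_eigenvalues[OF assms] by (simp add: eigenvalue_mset_def count_sum)

lemma vdegree_less_CARD:
  fixes adj :: "'v::finite \<Rightarrow> 'v \<Rightarrow> bool"
  assumes "irreflp adj"
  shows "vdegree adj x < CARD('v)"
proof -
  have "{y. adj x y} \<subset> UNIV" using assms by (auto simp: irreflp_def)
  then show ?thesis unfolding vdegree_def by (intro psubset_card_mono) auto
qed

lemma dim_constant_functions_le_1:
  fixes S :: "(real ^ 'v::finite) set"
  assumes "\<And>f x y. f \<in> S \<Longrightarrow> f $ x = f $ y"
  shows "dim S \<le> 1"
proof -
  have "S \<subseteq> span {\<chi> x. 1}"
  proof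
    fix f assume "f \<in> S"
    then have "f = (f $ undefined) *\<^sub>R (\<chi> x. 1)" using assms by (simp add: vec_eq_iff)
    then show "f \<in> span {\<chi> x. 1}" by (metis span_base span_scale insertI1)
  qed
  then have "dim S \<le> card {(\<chi> x. 1) :: real ^ 'v}" by (intro dim_le_card) auto
  then show ?thesis by simp
qed

text \<open>
  The first \<open>deg(x) + 1\<close> entries of the sorted spectrum are at most \<open>K\<close>. At most one of them is
  smaller than \<open>K\<close>, because eigenfunctions for eigenvalues below \<open>K\<close> are constant; all the
  others are equal to \<open>K\<close>.
\<close>

lemma vdegree_le_dim_eigenspace:
  fixes adj :: "'v::finite \<Rightarrow> 'v \<Rightarrow> bool"
  assumes "symp adj" "irreflp adj" "\<forall>x y. adj\<^sup>*\<^sup>* x y" "CD_infinity adj K"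
    and "laplace_eigenvalue adj (vdegree adj x) = K"
  shows "vdegree adj x \<le> dim (eigenspace adj K)"
proof -
  let ?M = "eigenvalue_mset adj"
  define k where "k = vdegree adj x"
  define xs where "xs = sorted_list_of_multiset ?M"
  have M: "mset xs = ?M" and sorted: "sorted xs" by (simp_all add: xs_def)
  have len: "k < length xs"
    using vdegree_less_CARD[OF assms(2), of x] size_eigenvalue_mset_ge[OF assms(1)]
    by (simp add: k_def flip: M)
  have k: "xs ! k = K" using assms(5) by (simp add: laplace_eigenvalue_def k_def xs_def)
  have low: "count ?M t \<le> (if t = 0 then 1 else 0)" if "t < K" for t
  proof -
    note const = eigen_below_curvature_const[OF assms(1,3,4) _ \<open>t < K\<close>]
    have "t = 0" if "t \<in> eigenvalues adj"
    proof -
      obtain f where f: "f \<noteq> 0" "f \<in> eigenspace adj t" using \<open>t \<in> eigenvalues adj\<close>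
        by (auto simp: eigenvalues_def)
      obtain z where "f $ z \<noteq> 0" using f(1) by (auto simp: vec_eq_iff)
      moreover have "laplacian adj (($) f) z = 0"
        using const[OF f(2), of _ z] by (auto simp: laplacian_def intro!: sum.neutral)
      ultimately show ?thesis using laplacian_eigen[OF f(2), of z] by simp
    qed
    moreover have "dim (eigenspace adj t) \<le> 1"
      using const by (rule dim_constant_functions_le_1)
    ultimately show ?thesis by (auto simp: count_eigenvalue_mset[OF assms(1)])
  qed
  have "filter_mset (\<lambda>t. t < K) ?M \<subseteq># {#0#}"
  proof (rule mset_subset_eqI)
    show "count (filter_mset (\<lambda>t. t < K) ?M) t \<le> count {#0#} t" for t
      using low[of t] by (cases "t < K"; cases "t = 0") simp_all
  qed
  then have lt: "size (filter_mset (\<lambda>t. t < K) ?M) \<le> 1"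
    by (auto dest: size_mset_mono)
  have "\<forall>t\<in>set (take (Suc k) xs). t \<le> K"
    using sorted len k by (auto simp: in_set_conv_nth less_Suc_eq_le sorted_iff_nth_mono)
  then have "filter_mset (\<lambda>t. t \<le> K) (mset (take (Suc k) xs)) = mset (take (Suc k) xs)"
    by (simp add: filter_mset_eq_conv)
  moreover have "mset (take (Suc k) xs) \<subseteq># ?M"
    unfolding M[symmetric] by (metis append_take_drop_id mset_append mset_subset_eq_add_left)
  ultimately have "mset (take (Suc k) xs) \<subseteq># filter_mset (\<lambda>t. t \<le> K) ?M"
    by (metis multiset_filter_mono)
  then have "Suc k \<le> size (filter_mset (\<lambda>t. t \<le> K) ?M)"
    using len size_mset_mono by fastforce
  also have "filter_mset (\<lambda>t. t \<le> K) ?M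
      = filter_mset (\<lambda>t. t < K) ?M + replicate_mset (count ?M K) K"
    by (rule multiset_eqI) auto
  also have "size \<dots> \<le> 1 + count ?M K" using lt by simp
  also have "count ?M K \<le> dim (eigenspace adj K)"
    by (simp add: count_eigenvalue_mset[OF assms(1)])
  finally show ?thesis by (simp add: k_def)
qed

theorem theorem7p4:
  fixes adj :: "'v::finite \<Rightarrow> 'v \<Rightarrow> bool"
  assumes "symp adj" and "irreflp adj"
    and "\<forall>x y. adj\<^sup>*\<^sup>* x y"
    and "CD_infinity adj 2"
    and "\<exists>v. laplace_eigenvalue adj (vdegree adj v) = 2"
  shows "regular_graph adj"
proof -
  obtain v where v: "laplace_eigenvalue adj (vdegree adj v) = 2" using assms(5) by blast
  define d where "d = dim (eigenspace adj 2)"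
  have le: "d \<le> vdegree adj x" for x
    unfolding d_def using assms by (intro dim_extremal_eigenspace_le_vdegree) auto
  have "vdegree adj x = d" for x
  proof -
    have "adj\<^sup>*\<^sup>* v x" using assms(3) by blast
    then show ?thesis
    proof induction
      case base
      show ?case
        using vdegree_le_dim_eigenspace[OF assms(1-4) v] le[of v] by (simp add: d_def)
    next
      case (step x y)
      have "vdegree adj x \<le> dim (eigenspace adj 2)" using step by (simp add: d_def)
      then obtain f where "f \<in> eigenspace adj 2" "gradient_at adj x f = axis y 1"
        using extremal_eigenfunction_with_gradient[OF assms(1,3,4)] step(2) by auto
      then have "vdegree adj y \<le> vdegree adj x"
        using vdegree_neighbour[OF assms(1,2,4) _ _ step(2)] by fastforce
      with step le[of y] show ?case by simp
    qed
  qed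
  then show ?thesis by (auto simp: regular_graph_def)
qed

end
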